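(* Let $\mathcal{G}$ be any network and let $i$ be any node of $\mathcal{G}$. Let $a_i(\ell)$ be the number of walks of length $\ell$ in $\mathcal{G}$ terminating at $i$. Then: (a) The limit $\delta(i)=\lim_{\ell\to\infty}(a_i(\ell))^{1/\ell}$ exists and satisfies $\delta(i)\ge 0$ (node $i$ has a well-defined branching ratio). (b) $\delta(i)$ is the maximum of the branching ratios $\delta(\mathcal{H})$ as $\mathcal{H}$ runs over all upstream SCCs of $i$. (c) $\delta(i)$ is equal to the Perron eigenvalue $\rho(i)$ of the adjacency matrix of the upstream subnetwork $\mathcal{U}(i)$.
   Context: A network is a finite directed multigraph (self-loops and multiple edges allowed). If its nodes are $1,\dots,n$, its adjacency matrix is the $n\times n$ matrix whose $(i,j)$ entry is the number of edges from $i$ to $j$. A walk of length $\ell$ from $j$ to $i$ is a sequence of nodes and edges $i=x_0\stackrel{e_1}{\leftarrow}x_1\stackrel{e_2}{\leftarrow}\cdots\stackrel{e_\ell}{\leftarrow}x_\ell=j$ with $e_t$ an edge from $x_t$ to $x_{t-1}$ (for $\ell=0$ it is a single node); it terminates at $i$. Different parallel edges give different walks; nodes and edges may repeat. For a set $X$ of nodes, $\mathcal{G}[X]$ is the induced subnetwork: its nodes are the elements of $X$ and its edges are all edges of $\mathcal{G}$ with source and target in $X$. A node $j$ is upstream from $i$ if there is a walk (possibly of length $0$) from $j$ to $i$; the upstream subnetwork $\mathcal{U}(i)$ is the subnetwork induced by all nodes upstream from $i$. A network is strongly connected if for any two distinct nodes $i,j$ there is a walk from $i$ to $j$; a strongly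 connected component (SCC) of $\mathcal{G}$ is a maximal set $X$ of nodes with $\mathcal{G}[X]$ strongly connected (also identified with the network $\mathcal{G}[X]$). An upstream SCC of $i$ is an SCC of $\mathcal{G}$ that contains a node upstream from $i$. The Perron eigenvalue of a non-negative square matrix is its spectral radius, which is itself an eigenvalue. In a strongly connected network $\mathcal{H}$, all nodes $j$ have the same branching ratio $\lim_{\ell\to\infty}(b_j(\ell))^{1/\ell}$, where $b_j(\ell)$ is the number of walks of length $\ell$ within $\mathcal{H}$ terminating at $j$; this common value is denoted $\delta(\mathcal{H})$. *)

theory Defs
  imports
    "Graph_Theory.Digraph_Component"
    "Jordan_Normal_Form.Spectral_Radius"
begin

text \<open>
  Networks are \<^locale>\<open>fin_digraph\<close>s, which allow self-loops and parallel arcs.  A walk is recorded as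
  its start node together with its list of arcs in the direction of travel, so parallel arcs give
  different walks; the start node is needed only to represent walks of length \<open>0\<close>.
\<close>

definition walks_to :: "('a,'b) pre_digraph \<Rightarrow> 'a \<Rightarrow> nat \<Rightarrow> ('a \<times> 'b list) set" where
  "walks_to G i l = {(j, p). pre_digraph.awalk G j p i \<and> length p = l}"

text \<open>
  The value at \<open>l = 0\<close> is \<^term>\<open>root 0 x = 0\<close> and is irrelevant for the limit.
\<close>

definition branching_seq :: "('a,'b) pre_digraph \<Rightarrow> 'a \<Rightarrow> nat \<Rightarrow> real" where
  "branching_seq G i l = root l (real (card (walks_to G i l)))"

definition branching_ratio :: "('a,'b) pre_digraph \<Rightarrow> 'a \<Rightarrow> real" where
  "branching_ratio G i = lim (branching_seq G i)"

text \<open>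
  The common branching ratio of all nodes of a strongly connected network; walks are counted
  within \<open>H\<close> only.  Unspecified if there is no such common limit.
\<close>

definition network_branching_ratio :: "('a,'b) pre_digraph \<Rightarrow> real" where
  "network_branching_ratio H = (THE d. \<forall>j \<in> verts H. branching_seq H j \<longlonglongrightarrow> d)"

definition upstream :: "('a,'b) pre_digraph \<Rightarrow> 'a \<Rightarrow> 'a set" where
  "upstream G i = {j. \<exists>p. pre_digraph.awalk G j p i}"

definition upstream_subnetwork :: "('a,'b) pre_digraph \<Rightarrow> 'a \<Rightarrow> ('a,'b) pre_digraph" where
  "upstream_subnetwork G i = G \<restriction> upstream G i"

definition upstream_sccs :: "('a,'b) pre_digraph \<Rightarrow> 'a \<Rightarrow> ('a,'b) pre_digraph set" where
  "upstream_sccs G i = {H \<in> pre_digraph.sccs G. verts H \<inter> upstream G i \<noteq> {}}"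

text \<open>
  The list \<open>xs\<close> enumerates the nodes of \<open>H\<close>, i.e. it is the identification of the nodes with
  \<open>1, \<dots>, n\<close>; matrix indices start at \<open>0\<close>.
\<close>

definition adjacency_matrix :: "('a,'b) pre_digraph \<Rightarrow> 'a list \<Rightarrow> real mat" where
  "adjacency_matrix H xs = Matrix.mat (length xs) (length xs)
     (\<lambda>(a, b). real (card {e \<in> arcs H. tail H e = xs ! a \<and> head H e = xs ! b}))"

text \<open>The spectral radius ranges over the complex eigenvalues of the matrix.\<close>

definition perron_eigenvalue :: "real mat \<Rightarrow> real" where
  "perron_eigenvalue A = spectral_radius (map_mat complex_of_real A)"

end

theory Submission
  imports Defs
begin

text \<open>
  Removing the last arc of a walk gives the recursion
  \<open>a\<^sub>k(l + 1) = (\<Sum>e. a\<^bsub>tail e\<^esub>(l))\<close>, the sum running over the arcs \<open>e\<close> into \<open>k\<close>.  Hence the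
  numbers \<open>a\<^sub>k(l)\<close> are the column sums of the powers of the adjacency matrix, and growth rates can be
  read off from its left eigenvectors.  Such an eigenvector is treated here as a function \<open>w\<close> on the
  nodes with \<open>(\<Sum>e. w (tail e)) = \<mu> * w k\<close> for every node \<open>k\<close> (\<open>eigenfunction\<close>).

  Let \<open>\<rho>\<close> be the spectral radius of the adjacency matrix of the upstream subnetwork \<open>U\<close> of \<open>i\<close>.
  All walks that terminate at \<open>i\<close> stay in \<open>U\<close>, so \<open>a\<^sub>i(l)\<close> may be counted in \<open>U\<close>.
  From above, the entries of the \<open>l\<close>-th matrix power are \<open>O(s^l)\<close> for every \<open>s > \<rho>\<close>
  (\<open>spectral_radius_pow_bound\<close>).  From below, choose an eigenfunction \<open>w\<close> with \<open>\<bar>\<mu>\<bar> = \<rho>\<close> and a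
  node \<open>k\<close> with \<open>w k \<noteq> 0\<close>.  The triangle inequality in the recursion gives
  \<open>\<rho>^l * \<bar>w k\<bar> \<le> W * a\<^sub>k(l)\<close> with a constant \<open>W\<close> (\<open>eigenfunction_le_card_walks_to\<close>), and
  \<open>a\<^sub>k(l) \<le> a\<^sub>i(l + d)\<close> because \<open>k\<close> reaches \<open>i\<close> by some walk, of length \<open>d\<close> say.  The two bounds
  force the \<open>l\<close>-th roots to converge to \<open>\<rho>\<close> (\<open>branching_seq_tendsto_perron\<close>).

  A strongly connected network is its own upstream subnetwork at each of its nodes, so its
  branching ratio is the spectral radius of its own adjacency matrix.  For an upstream component
  \<open>H\<close>, prolonging the walks inside \<open>H\<close> by a fixed walk to \<open>i\<close> shows that the ratio of \<open>H\<close> is at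
  most that of \<open>i\<close>.  Equality holds for a component that is as far upstream as possible among those
  where \<open>w\<close> does not vanish: nothing outside it contributes to the eigenvalue equation at its nodes,
  so \<open>w\<close> is still an eigenfunction there, with the same \<open>\<mu>\<close>
  (\<open>eigenfunction_restrict_scc\<close>).  Its spectral radius is therefore at least \<open>\<bar>\<mu>\<bar> = \<rho>\<close>.
\<close>

section \<open>Counting walks\<close>

context fin_digraph
begin

lemma walks_to_0: "j \<in> verts G \<Longrightarrow> walks_to G j 0 = {(j, [])}"
  by (auto simp: walks_to_def awalk_Nil_iff)

lemma finite_walks_to: "finite (walks_to G j l)"
proof (rule finite_subset)
  show "walks_to G j l \<subseteq> verts G \<times> {p. set p \<subseteq> arcs G \<and> length p = l}"
    by (auto simp: walks_to_def awalk_def)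
qed (intro finite_cartesian_product finite_lists_length_eq; simp)

lemma walks_to_Suc:
  "walks_to G j (Suc l) = (\<Union>e \<in> in_arcs G j. (\<lambda>(u, p). (u, p @ [e])) ` walks_to G (tail G e) l)"
  (is "?L = ?R")
proof
  show "?L \<subseteq> ?R"
  proof
    fix x assume "x \<in> ?L"
    then obtain u p where x: "x = (u, p)" and w: "awalk u p j" and len: "length p = Suc l"
      by (auto simp: walks_to_def)
    from len obtain q e where p: "p = q @ [e]" and "length q = l"
      by (metis length_Suc_conv_rev)
    moreover from w have "awalk u q (tail G e)" "awalk (tail G e) [e] j"
      unfolding p by (auto simp: awalk_simps)
    ultimately show "x \<in> ?R"
      by (force simp: x walks_to_def awalk_simps)
  qed
  show "?R \<subseteq> ?L"
    by (auto simp: walks_to_def awalk_simps)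
qed

lemma card_walks_to_Suc:
  "card (walks_to G j (Suc l)) = (\<Sum>e \<in> in_arcs G j. card (walks_to G (tail G e) l))"
proof -
  have inj: "inj_on (\<lambda>(u, p). (u, p @ [e])) S" for e :: 'b and S :: "('a \<times> 'b list) set"
    by (auto simp: inj_on_def)
  show ?thesis unfolding walks_to_Suc
    by (subst card_UN_disjoint) (auto simp: finite_walks_to card_image[OF inj])
qed

text \<open>
  Appending the fixed walk \<open>q\<close> is injective, so node \<open>i\<close> grows at least as fast as every node
  upstream from it, up to a shift of the length.
\<close>

lemma card_walks_to_append:
  assumes "awalk k q i"
  shows "card (walks_to G k l) \<le> card (walks_to G i (l + length q))"
proof (rule card_inj_on_le)
  show "inj_on (\<lambda>(u, p). (u, p @ q)) (walks_to G k l)" by (auto simp: inj_on_def)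
  show "(\<lambda>(u, p). (u, p @ q)) ` walks_to G k l \<subseteq> walks_to G i (l + length q)"
    using assms by (auto simp: walks_to_def intro: awalk_appendI)
qed (rule finite_walks_to)

lemma card_walks_to_subgraph:
  assumes "subgraph H G"
  shows "card (walks_to H j l) \<le> card (walks_to G j l)"
  by (rule card_mono[OF finite_walks_to])
    (auto simp: walks_to_def intro: subgraph_awalk_imp_awalk[OF _ assms])

lemma upstream_iff: "j \<in> upstream G i \<longleftrightarrow> j \<rightarrow>\<^sup>*\<^bsub>G\<^esub> i"
  by (auto simp: upstream_def reachable_awalk)

lemma upstream_subset: "upstream G i \<subseteq> verts G"
  by (auto simp: upstream_def)

lemma tail_in_upstream:
  assumes "e \<in> in_arcs G j" "j \<in> upstream G i"
  shows "tail G e \<in> upstream G i"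
proof -
  from assms obtain p where "e \<in> arcs G" "awalk (head G e) p i" by (auto simp: upstream_def)
  then have "awalk (tail G e) (e # p) i" by (simp add: awalk_simps)
  then show ?thesis by (auto simp: upstream_def)
qed

lemma fin_digraph_upstream_subnetwork: "fin_digraph (upstream_subnetwork G i)"
  unfolding upstream_subnetwork_def
  by (intro fin_digraph_subgraph induced_imp_subgraph induced_induce upstream_subset)

lemma in_arcs_upstream_subnetwork:
  assumes "j \<in> upstream G i"
  shows "in_arcs (upstream_subnetwork G i) j = in_arcs G j"
  using assms tail_in_upstream[OF _ assms]
  by (auto simp: upstream_subnetwork_def)

text \<open>
  Every node on a walk to \<open>j\<close> is upstream from \<open>j\<close>, hence from \<open>i\<close>; so the passage to the upstream
  subnetwork loses no walk.
\<close>

lemma walks_to_upstream_subnetwork: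
  assumes "j \<in> upstream G i"
  shows "walks_to (upstream_subnetwork G i) j l = walks_to G j l"
  using assms
proof (induction l arbitrary: j)
  case 0
  then have "j \<in> verts G" using upstream_subset by blast
  with 0 show ?case
    using fin_digraph.walks_to_0[OF fin_digraph_upstream_subnetwork, of j i]
    by (simp add: walks_to_0 upstream_subnetwork_def)
next
  case (Suc l)
  interpret U: fin_digraph "upstream_subnetwork G i" by (rule fin_digraph_upstream_subnetwork)
  have "tail G e \<in> upstream G i" if "e \<in> in_arcs G j" for e
    using that Suc.prems by (rule tail_in_upstream)
  then show ?case
    unfolding U.walks_to_Suc walks_to_Suc in_arcs_upstream_subnetwork[OF Suc.prems]
    using Suc.IH by (auto simp: upstream_subnetwork_def)
qed

end

lemma upstream_subnetwork_strongly_connected: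
  assumes "fin_digraph H" "strongly_connected H" "j \<in> verts H"
  shows "upstream_subnetwork H j = H"
proof -
  interpret fin_digraph H by fact
  have "upstream H j = verts H"
    using assms upstream_subset by (auto simp: upstream_iff strongly_connected_def)
  then show ?thesis
    by (auto simp: upstream_subnetwork_def induce_subgraph_def intro!: pre_digraph.equality)
qed

section \<open>Eigenfunctions of a network\<close>

text \<open>
  These are the left eigenvectors of the adjacency matrix, written without an enumeration of the
  nodes.  This makes it possible to restrict one to a subnetwork.  The values are complex because
  the spectral radius is a maximum over the complex eigenvalues.
\<close>

definition eigenfunction :: "('a,'b) pre_digraph \<Rightarrow> ('a \<Rightarrow> complex) \<Rightarrow> complex \<Rightarrow> bool" where
  "eigenfunction H w \<mu> \<longleftrightarrow> (\<exists>k \<in> verts H. w k \<noteq> 0) \<and>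
     (\<forall>k \<in> verts H. (\<Sum>e \<in> in_arcs H k. w (tail H e)) = \<mu> * w k)"

text \<open>
  By the triangle inequality the eigenvalue equation bounds \<open>\<bar>\<mu>\<bar> * \<bar>w k\<bar>\<close> by the sum of \<open>\<bar>w\<bar>\<close> over
  the tails of the arcs into \<open>k\<close>, and the walk counts obey the same recursion with equality.  The
  total mass of \<open>\<bar>w\<bar>\<close> is a factor that makes the counts dominate \<open>\<bar>w\<bar>\<close> at length \<open>0\<close>.
\<close>

lemma (in fin_digraph) eigenfunction_le_card_walks_to:
  assumes w: "eigenfunction G w \<mu>" and "k \<in> verts G"
  shows "cmod \<mu> ^ l * cmod (w k) \<le> (\<Sum>v \<in> verts G. cmod (w v)) * card (walks_to G k l)"
    (is "_ \<le> ?W * _")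
  using \<open>k \<in> verts G\<close>
proof (induction l arbitrary: k)
  case 0
  then show ?case by (auto simp: walks_to_0 intro: member_le_sum)
next
  case (Suc l)
  have "cmod \<mu> ^ Suc l * cmod (w k) = cmod \<mu> ^ l * cmod (\<Sum>e \<in> in_arcs G k. w (tail G e))"
    using w Suc.prems by (simp add: eigenfunction_def norm_mult)
  also have "\<dots> \<le> cmod \<mu> ^ l * (\<Sum>e \<in> in_arcs G k. cmod (w (tail G e)))"
    by (intro mult_left_mono norm_sum) auto
  also have "\<dots> = (\<Sum>e \<in> in_arcs G k. cmod \<mu> ^ l * cmod (w (tail G e)))"
    by (rule sum_distrib_left)
  also have "\<dots> \<le> (\<Sum>e \<in> in_arcs G k. ?W * card (walks_to G (tail G e) l))"
    by (intro sum_mono Suc.IH) auto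
  also have "\<dots> = ?W * card (walks_to G k (Suc l))"
    by (simp add: card_walks_to_Suc sum_distrib_left)
  finally show ?case .
qed

lemma adjacency_matrix_carrier [simp]:
  "adjacency_matrix H xs \<in> carrier_mat (length xs) (length xs)"
  by (simp add: adjacency_matrix_def)

text \<open>
  Parallel arcs are collected in the entries of the matrix; grouping the arcs into a node by their
  tails turns a sum over arcs into a sum over matrix entries.
\<close>

lemma (in fin_digraph) sum_adjacency_column:
  fixes f :: "'a \<Rightarrow> complex"
  assumes xs: "distinct xs" "set xs = verts G" and b: "b < length xs"
  shows "(\<Sum>c < length xs. map_mat complex_of_real (adjacency_matrix G xs) $$ (c, b) * f (xs ! c))
       = (\<Sum>e \<in> in_arcs G (xs ! b). f (tail G e))"
proof -
  let ?S = "\<lambda>v. {e \<in> in_arcs G (xs ! b). tail G e = v}"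
  have "(\<Sum>c < length xs. map_mat complex_of_real (adjacency_matrix G xs) $$ (c, b) * f (xs ! c))
      = (\<Sum>c < length xs. (\<lambda>v. of_nat (card (?S v)) * f v) (xs ! c))"
    using b by (intro sum.cong refl) (auto simp: adjacency_matrix_def in_arcs_def intro!: arg_cong[where f=card])
  also have "\<dots> = (\<Sum>v \<in> verts G. of_nat (card (?S v)) * f v)"
    using sum.reindex_bij_betw[OF bij_betw_nth[OF xs(1) refl refl]] xs(2) by simp
  also have "\<dots> = (\<Sum>v \<in> verts G. \<Sum>e \<in> ?S v. f (tail G e))"
    by (intro sum.cong refl) auto
  also have "\<dots> = (\<Sum>e \<in> in_arcs G (xs ! b). f (tail G e))"
    by (rule sum.group) auto
  finally show ?thesis .
qed

lemma eigenvalue_transpose: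
  fixes A :: "'a :: field mat"
  assumes "A \<in> carrier_mat n n"
  shows "eigenvalue (transpose_mat A) k \<longleftrightarrow> eigenvalue A k"
  using assms by (simp add: eigenvalue_root_char_poly[where n = n])

text \<open>
  Eigenfunctions are eigenvectors of the transposed matrix, which has the same characteristic
  polynomial.
\<close>

lemma (in fin_digraph) eigenvalue_iff_eigenfunction:
  assumes xs: "distinct xs" "set xs = verts G"
  shows "eigenvalue (map_mat complex_of_real (adjacency_matrix G xs)) \<mu>
     \<longleftrightarrow> (\<exists>w. eigenfunction G w \<mu>)"
proof -
  define A where "A = map_mat complex_of_real (adjacency_matrix G xs)"
  define n where "n = length xs"
  have A: "A \<in> carrier_mat n n" by (simp add: A_def n_def)
  have col: "(transpose_mat A *\<^sub>v v) $ b = (\<Sum>e \<in> in_arcs G (xs ! b). f (tail G e))"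
    if "v \<in> carrier_vec n" "b < n" "\<And>c. c < n \<Longrightarrow> v $ c = f (xs ! c)" for v f b
  proof -
    have "(transpose_mat A *\<^sub>v v) $ b = (\<Sum>c < n. A $$ (c, b) * f (xs ! c))"
      using that A by (auto simp: scalar_prod_def lessThan_atLeast0 intro!: sum.cong)
    then show ?thesis
      using sum_adjacency_column[OF xs, of b f] that by (simp add: A_def n_def)
  qed
  have "eigenvalue (transpose_mat A) \<mu> \<longleftrightarrow> (\<exists>w. eigenfunction G w \<mu>)"
  proof
    assume "eigenvalue (transpose_mat A) \<mu>"
    then obtain v where v: "v \<in> carrier_vec n" "v \<noteq> 0\<^sub>v n" "transpose_mat A *\<^sub>v v = \<mu> \<cdot>\<^sub>v v"
      using A by (auto simp: eigenvalue_def eigenvector_def)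
    define w where "w x = v $ (THE c. c < n \<and> xs ! c = x)" for x
    have vw: "v $ c = w (xs ! c)" if "c < n" for c
    proof -
      have "(THE d. d < n \<and> xs ! d = xs ! c) = c"
        using that xs(1) by (auto simp: n_def nth_eq_iff_index_eq)
      then show ?thesis by (simp add: w_def)
    qed
    obtain c where "c < n" "v $ c \<noteq> 0"
      using v by (metis carrier_vecD eq_vecI index_zero_vec(1) index_zero_vec(2))
    then have "\<exists>k \<in> verts G. w k \<noteq> 0"
      using vw xs(2) by (metis n_def nth_mem)
    moreover have "(\<Sum>e \<in> in_arcs G k. w (tail G e)) = \<mu> * w k" if k: "k \<in> verts G" for k
    proof -
      from k xs(2) obtain b where b: "b < n" "k = xs ! b"
        by (metis in_set_conv_nth n_def)
      have "(\<Sum>e \<in> in_arcs G k. w (tail G e)) = (\<mu> \<cdot>\<^sub>v v) $ b"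
        using col[OF v(1) b(1) vw] v(3) b by simp
      then show ?thesis using v(1) b vw by simp
    qed
    ultimately show "\<exists>w. eigenfunction G w \<mu>" by (auto simp: eigenfunction_def)
  next
    assume "\<exists>w. eigenfunction G w \<mu>"
    then obtain w k where w: "k \<in> verts G" "w k \<noteq> 0"
      "\<And>k. k \<in> verts G \<Longrightarrow> (\<Sum>e \<in> in_arcs G k. w (tail G e)) = \<mu> * w k"
      by (auto simp: eigenfunction_def)
    define v where "v = vec n (\<lambda>c. w (xs ! c))"
    have v: "v \<in> carrier_vec n" by (simp add: v_def)
    from w(1) xs(2) obtain c where "c < n" "k = xs ! c"
      by (metis in_set_conv_nth n_def)
    then have "v $ c \<noteq> 0\<^sub>v n $ c" using w(2) by (simp add: v_def)
    then have "v \<noteq> 0\<^sub>v n" by auto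
    moreover have "transpose_mat A *\<^sub>v v = \<mu> \<cdot>\<^sub>v v"
    proof (rule eq_vecI)
      fix b assume "b < dim_vec (\<mu> \<cdot>\<^sub>v v)"
      then have b: "b < n" by (simp add: v_def)
      moreover have "xs ! b \<in> verts G" using b xs(2) by (metis n_def nth_mem)
      ultimately show "(transpose_mat A *\<^sub>v v) $ b = (\<mu> \<cdot>\<^sub>v v) $ b"
        using col[OF v b, of w] w(3) by (simp add: v_def)
    qed (use A in \<open>simp add: v_def\<close>)
    ultimately show "eigenvalue (transpose_mat A) \<mu>"
      using v A by (auto simp: eigenvalue_def eigenvector_def)
  qed
  then show ?thesis
    using eigenvalue_transpose[OF A] by (simp add: A_def)
qed

lemma (in fin_digraph)
  assumes xs: "distinct xs" "set xs = verts G" and ne: "verts G \<noteq> {}"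
  shows eigenfunction_perron_exists:
      "\<exists>\<mu> w. eigenfunction G w \<mu> \<and> cmod \<mu> = perron_eigenvalue (adjacency_matrix G xs)"
    and eigenfunction_le_perron:
      "eigenfunction G w \<mu> \<Longrightarrow> cmod \<mu> \<le> perron_eigenvalue (adjacency_matrix G xs)"
proof -
  have n: "length xs > 0" using xs(2) ne by auto
  have "map_mat complex_of_real (adjacency_matrix G xs) \<in> carrier_mat (length xs) (length xs)"
    by simp
  note mem_max = spectral_radius_mem_max[OF this n]
  show "\<exists>\<mu> w. eigenfunction G w \<mu> \<and> cmod \<mu> = perron_eigenvalue (adjacency_matrix G xs)"
    using mem_max(1) eigenvalue_iff_eigenfunction[OF xs]
    by (auto simp: spectrum_def perron_eigenvalue_def)
  show "cmod \<mu> \<le> perron_eigenvalue (adjacency_matrix G xs)" if "eigenfunction G w \<mu>"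
    unfolding perron_eigenvalue_def using that eigenvalue_iff_eigenfunction[OF xs]
    by (intro mem_max(2)) (auto simp: spectrum_def)
qed

section \<open>The exponential growth rate is the spectral radius\<close>

lemma smult_pow_mat:
  fixes A :: "'a :: comm_ring_1 mat"
  assumes A: "A \<in> carrier_mat n n"
  shows "(a \<cdot>\<^sub>m A) ^\<^sub>m l = a ^ l \<cdot>\<^sub>m (A ^\<^sub>m l)"
proof (induction l)
  case 0
  show ?case using A by (intro eq_matI) auto
next
  case (Suc l)
  have P: "A ^\<^sub>m l \<in> carrier_mat n n" using A by simp
  have "(a ^ l \<cdot>\<^sub>m (A ^\<^sub>m l)) * (a \<cdot>\<^sub>m A) = a \<cdot>\<^sub>m (a ^ l \<cdot>\<^sub>m (A ^\<^sub>m l * A))"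
    using A P by (simp add: mult_smult_assoc_mat[of _ n n _ n] mult_smult_distrib[of _ n n _ n])
  also have "\<dots> = a ^ Suc l \<cdot>\<^sub>m (A ^\<^sub>m l * A)"
    by (intro eq_matI) (auto simp: mult.assoc)
  finally show ?case by (simp add: Suc.IH)
qed

text \<open>
  Scaling by \<open>1 / c\<close> brings the spectral radius below \<open>1\<close>, where the powers of a matrix are bounded
  by its Jordan normal form.
\<close>

lemma spectral_radius_pow_bound:
  assumes A: "A \<in> carrier_mat n n" and n: "n > 0" and c: "spectral_radius A < c"
  shows "\<exists>C. \<forall>l. norm_bound (A ^\<^sub>m l) (C * c ^ l)"
proof -
  have "0 \<le> spectral_radius A"
    using spectral_radius_mem_max(1)[OF A n] by auto
  with c have c0: "c > 0" by simp
  define B where "B = complex_of_real (1 / c) \<cdot>\<^sub>m A"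
  have B: "B \<in> carrier_mat n n" using A by (simp add: B_def)
  obtain \<mu> where \<mu>: "eigenvalue B \<mu>" and sr: "spectral_radius B = cmod \<mu>"
    using spectral_radius_mem_max(1)[OF B n] by (auto simp: spectrum_def)
  from \<mu> obtain v where v: "v \<in> carrier_vec n" "v \<noteq> 0\<^sub>v n" "B *\<^sub>v v = \<mu> \<cdot>\<^sub>v v"
    using B by (auto simp: eigenvalue_def eigenvector_def)
  have "A = complex_of_real c \<cdot>\<^sub>m B"
    using c0 by (intro eq_matI) (auto simp: B_def)
  then have "A *\<^sub>v v = (complex_of_real c \<cdot>\<^sub>m B) *\<^sub>v v" by (rule arg_cong)
  also have "\<dots> = complex_of_real c \<cdot>\<^sub>v (B *\<^sub>v v)"
    using B v(1) by (intro eq_vecI) auto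
  also have "\<dots> = (c * \<mu>) \<cdot>\<^sub>v v"
    by (simp add: v(3) smult_smult_assoc)
  finally have "eigenvalue A (c * \<mu>)"
    using v A by (auto simp: eigenvalue_def eigenvector_def)
  then have "cmod (c * \<mu>) \<le> spectral_radius A"
    by (intro spectral_radius_mem_max(2)[OF A n]) (auto simp: spectrum_def)
  moreover have "cmod (c * \<mu>) = c * cmod \<mu>" using c0 by (simp add: norm_mult)
  ultimately have "c * cmod \<mu> < c" using c by linarith
  then have "spectral_radius B < 1" using c0 sr by simp
  from spectral_radius_jnf_norm_bound_less_1_upper_triangular[OF B this]
  obtain C where C: "\<And>l. norm_bound (B ^\<^sub>m l) C" by blast
  have "norm_bound (A ^\<^sub>m l) (C * c ^ l)" for l
  proof (rule norm_boundI)
    fix i j assume ij: "i < dim_row (A ^\<^sub>m l)" "j < dim_col (A ^\<^sub>m l)"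
    have "cmod ((B ^\<^sub>m l) $$ (i, j)) \<le> C"
      using C[of l] ij pow_carrier_mat[OF A, of l] pow_carrier_mat[OF B, of l]
      by (metis carrier_matD norm_bound_def)
    moreover have "(B ^\<^sub>m l) $$ (i, j) = complex_of_real ((1 / c) ^ l) * (A ^\<^sub>m l) $$ (i, j)"
      using ij unfolding B_def smult_pow_mat[OF A] by simp
    ultimately show "cmod ((A ^\<^sub>m l) $$ (i, j)) \<le> C * c ^ l"
      using c0 by (simp add: norm_mult norm_power norm_divide power_divide field_simps)
  qed
  then show ?thesis by blast
qed

text \<open>The start node of the walk ranges over all nodes, which is why a whole column is summed.\<close>

lemma (in fin_digraph) card_walks_to_eq_column_sum:
  assumes xs: "distinct xs" "set xs = verts G" and "b < length xs"
  shows "of_nat (card (walks_to G (xs ! b) l))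
    = (\<Sum>a < length xs. (map_mat complex_of_real (adjacency_matrix G xs) ^\<^sub>m l) $$ (a, b))"
  using \<open>b < length xs\<close>
proof (induction l arbitrary: b)
  case 0
  then have "xs ! b \<in> verts G" using xs(2) by (metis nth_mem)
  with 0 show ?case by (simp add: walks_to_0 adjacency_matrix_def)
next
  case (Suc l)
  define A where "A = map_mat complex_of_real (adjacency_matrix G xs)"
  let ?n = "length xs"
  have A: "A \<in> carrier_mat ?n ?n" by (simp add: A_def)
  have P: "A ^\<^sub>m l \<in> carrier_mat ?n ?n" using A by simp
  have "of_nat (card (walks_to G (xs ! b) (Suc l)))
      = (\<Sum>e \<in> in_arcs G (xs ! b). complex_of_nat (card (walks_to G (tail G e) l)))"
    by (simp add: card_walks_to_Suc)
  also have "\<dots> = (\<Sum>c < ?n. A $$ (c, b) * of_nat (card (walks_to G (xs ! c) l)))"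
    unfolding A_def by (rule sum_adjacency_column[OF xs Suc.prems, symmetric])
  also have "\<dots> = (\<Sum>c < ?n. A $$ (c, b) * (\<Sum>a < ?n. (A ^\<^sub>m l) $$ (a, c)))"
    using Suc.IH by (intro sum.cong refl) (simp add: A_def)
  also have "\<dots> = (\<Sum>a < ?n. \<Sum>c < ?n. (A ^\<^sub>m l) $$ (a, c) * A $$ (c, b))"
    by (subst sum.swap) (simp add: sum_distrib_left mult.commute)
  also have "\<dots> = (\<Sum>a < ?n. (A ^\<^sub>m Suc l) $$ (a, b))"
    using A P Suc.prems
    by (intro sum.cong refl) (auto simp: scalar_prod_def lessThan_atLeast0)
  finally show ?case by (simp add: A_def)
qed

lemma (in fin_digraph) card_walks_to_le_perron:
  fixes c :: real
  assumes xs: "distinct xs" "set xs = verts G" and j: "j \<in> verts G"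
    and c: "perron_eigenvalue (adjacency_matrix G xs) < c"
  shows "\<exists>C. \<forall>l. card (walks_to G j l) \<le> C * c ^ l"
proof -
  define A where "A = map_mat complex_of_real (adjacency_matrix G xs)"
  let ?n = "length xs"
  have A: "A \<in> carrier_mat ?n ?n" by (simp add: A_def)
  from j xs(2) obtain b where b: "b < ?n" "j = xs ! b" by (metis in_set_conv_nth)
  obtain C where C: "\<And>l. norm_bound (A ^\<^sub>m l) (C * c ^ l)"
    using spectral_radius_pow_bound[OF A, of c] c b by (cases xs) (auto simp: perron_eigenvalue_def A_def)
  have "card (walks_to G j l) \<le> (?n * C) * c ^ l" for l
  proof -
    have "real (card (walks_to G j l)) = cmod (\<Sum>a < ?n. (A ^\<^sub>m l) $$ (a, b))"
      using card_walks_to_eq_column_sum[OF xs b(1), of l] b(2) unfolding A_def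
      by (metis norm_of_nat)
    also have "\<dots> \<le> (\<Sum>a < ?n. C * c ^ l)"
      using C[of l] A b(1) by (intro sum_norm_le) (auto simp: norm_bound_def)
    finally show ?thesis by simp
  qed
  then show ?thesis by blast
qed

lemma root_exponential_tendsto:
  fixes b s :: real
  assumes "b > 0" "s \<ge> 0"
  shows "(\<lambda>l. root l (b * s ^ l)) \<longlonglongrightarrow> s"
proof -
  have "(\<lambda>l. root l b * s) \<longlonglongrightarrow> 1 * s"
    by (intro tendsto_intros LIMSEQ_root_const assms)
  moreover have "\<forall>\<^sub>F l in sequentially. root l b * s = root l (b * s ^ l)"
    using eventually_gt_at_top[of 0]
    by eventually_elim (simp add: real_root_mult real_root_power_cancel assms)
  ultimately show ?thesis by (simp add: filterlim_cong)
qed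

text \<open>
  The bound from above has a constant for each \<open>s > r\<close> rather than for \<open>r\<close> itself, since the powers
  of a matrix may exceed the powers of its spectral radius by a polynomial factor.
\<close>

lemma root_tendsto_growth_rate:
  fixes f :: "nat \<Rightarrow> real"
  assumes r: "0 \<le> r" and c: "0 < c"
    and lower: "\<And>l. d \<le> l \<Longrightarrow> c * r ^ l \<le> f l"
    and upper: "\<And>s. r < s \<Longrightarrow> \<exists>C. \<forall>l. f l \<le> C * s ^ l"
  shows "(\<lambda>l. root l (f l)) \<longlonglongrightarrow> r"
proof (rule order_tendstoI)
  fix a
  {
    assume "a < r"
    then have "\<forall>\<^sub>F l in sequentially. a < root l (c * r ^ l)"
      using root_exponential_tendsto[OF c r] by (rule order_tendstoD(1)[rotated])
    then show "\<forall>\<^sub>F l in sequentially. a < root l (f l)"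
      using eventually_gt_at_top[of 0] eventually_ge_at_top[of d]
    proof eventually_elim
      case (elim l)
      then show ?case using lower[of l] real_root_le_mono[of l "c * r ^ l" "f l"] by linarith
    qed
  }
  {
    assume a: "r < a"
    then obtain s where s: "r < s" "s < a" using dense by blast
    (* C may fail to be positive, so max C 1 replaces it where the limit of the roots is taken. *)
    obtain C where C: "\<And>l. f l \<le> C * s ^ l" using upper[OF s(1)] by blast
    have s0: "s \<ge> 0" using r s by simp
    have "\<forall>\<^sub>F l in sequentially. root l (max C 1 * s ^ l) < a"
      using root_exponential_tendsto[of "max C 1" s] s(2) s0 by (intro order_tendstoD(2)[of _ s]) auto
    then show "\<forall>\<^sub>F l in sequentially. root l (f l) < a"
      using eventually_gt_at_top[of 0]
    proof eventually_elim
      case (elim l)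
      have "f l \<le> max C 1 * s ^ l"
        using C[of l] mult_right_mono[of C "max C 1" "s ^ l"] s0 by simp
      then show ?case using elim real_root_le_mono[of l "f l" "max C 1 * s ^ l"] by linarith
    qed
  }
qed

text \<open>
  The lower bound starts at a node \<open>k\<close> in the support of an eigenfunction, which need not contain
  \<open>i\<close>.  It can be carried over to \<open>i\<close> because every node of the upstream subnetwork reaches \<open>i\<close>;
  in the whole network the corresponding statement fails.
\<close>

theorem branching_seq_tendsto_perron:
  assumes "fin_digraph G" and i: "i \<in> verts G"
    and xs: "distinct xs" "set xs = verts (upstream_subnetwork G i)"
  shows "branching_seq G i \<longlonglongrightarrow> perron_eigenvalue (adjacency_matrix (upstream_subnetwork G i) xs)"
proof -
  interpret fin_digraph G by fact
  let ?U = "upstream_subnetwork G i"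
  interpret U: fin_digraph ?U by (rule fin_digraph_upstream_subnetwork)
  define \<rho> where "\<rho> = perron_eigenvalue (adjacency_matrix ?U xs)"
  have VU: "verts ?U = upstream G i" by (simp add: upstream_subnetwork_def)
  have iU: "i \<in> upstream G i" using i by (simp add: upstream_iff)
  obtain \<mu> w where w: "eigenfunction ?U w \<mu>" and \<mu>: "cmod \<mu> = \<rho>"
    using U.eigenfunction_perron_exists[OF xs] iU VU by (auto simp: \<rho>_def)
  from w obtain k where k: "k \<in> verts ?U" "w k \<noteq> 0" by (auto simp: eigenfunction_def)
  from k(1) obtain q where q: "awalk k q i" by (auto simp: VU upstream_def)
  define W where "W = (\<Sum>v \<in> verts ?U. cmod (w v))"
  have "cmod (w k) \<le> W" unfolding W_def using k(1) by (intro member_le_sum) auto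
  with k(2) have W: "W > 0" by (smt (verit) zero_less_norm_iff)
  have \<rho>0: "\<rho> \<ge> 0" using \<mu> by auto
  (* The factor max \<rho> 1 pays for the shift by the length of q, and is nonzero also when \<rho> is 0. *)
  have low: "cmod (w k) / (W * max \<rho> 1 ^ length q) * \<rho> ^ l \<le> card (walks_to G i l)"
    if l: "length q \<le> l" for l
  proof -
    define m where "m = l - length q"
    have lm: "l = m + length q" using l by (simp add: m_def)
    have "\<rho> ^ m * cmod (w k) \<le> W * card (walks_to ?U k m)"
      using U.eigenfunction_le_card_walks_to[OF w k(1), of m] by (simp add: \<mu> W_def)
    also have "card (walks_to ?U k m) \<le> card (walks_to G i l)"
      using card_walks_to_append[OF q, of m] k(1)
      by (simp add: VU walks_to_upstream_subnetwork lm)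
    finally have "\<rho> ^ m * cmod (w k) \<le> W * card (walks_to G i l)" using W by simp
    moreover have "\<rho> ^ l \<le> \<rho> ^ m * max \<rho> 1 ^ length q"
      unfolding lm power_add using \<rho>0 by (intro mult_left_mono power_mono) auto
    ultimately have "cmod (w k) * \<rho> ^ l \<le> (W * card (walks_to G i l)) * max \<rho> 1 ^ length q"
      by (smt (verit) mult.assoc mult.commute mult_left_mono mult_right_mono norm_ge_zero zero_le_power)
    then show ?thesis using W by (simp add: field_simps)
  qed
  have "(\<lambda>l. root l (real (card (walks_to G i l)))) \<longlonglongrightarrow> \<rho>"
  proof (rule root_tendsto_growth_rate[OF \<rho>0 _ low])
    show "0 < cmod (w k) / (W * max \<rho> 1 ^ length q)" using W k(2) by simp
    show "\<exists>C. \<forall>l. real (card (walks_to G i l)) \<le> C * s ^ l" if "\<rho> < s" for s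
      using U.card_walks_to_le_perron[OF xs _ that[unfolded \<rho>_def], of i] iU
      by (simp add: VU walks_to_upstream_subnetwork)
  qed
  then show ?thesis by (simp add: \<rho>_def branching_seq_def[abs_def])
qed

section \<open>Strongly connected components\<close>

lemma strongly_connected_branching:
  assumes H: "fin_digraph H" "strongly_connected H" and xs: "distinct xs" "set xs = verts H"
  shows "network_branching_ratio H = perron_eigenvalue (adjacency_matrix H xs)"
    and "j \<in> verts H \<Longrightarrow> branching_seq H j \<longlonglongrightarrow> network_branching_ratio H"
proof -
  have lim: "branching_seq H j \<longlonglongrightarrow> perron_eigenvalue (adjacency_matrix H xs)" if "j \<in> verts H" for j
    using branching_seq_tendsto_perron[OF H(1) that, of xs] xs
    by (simp add: upstream_subnetwork_strongly_connected[OF H that])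
  obtain v where "v \<in> verts H" using H(2) by (auto simp: strongly_connected_def)
  then show *: "network_branching_ratio H = perron_eigenvalue (adjacency_matrix H xs)"
    unfolding network_branching_ratio_def
    by (intro the_equality) (use lim LIMSEQ_unique in blast)+
  show "branching_seq H j \<longlonglongrightarrow> network_branching_ratio H" if "j \<in> verts H"
    using lim[OF that] * by simp
qed

text \<open>
  For \<open>s > d\<close> the counts at \<open>i\<close> are eventually below \<open>s^l\<close>; those in \<open>H\<close> are then below \<open>s^l\<close> up
  to the constant \<open>s^(length q)\<close>, where \<open>q\<close> leads from \<open>H\<close> to \<open>i\<close>, and a constant factor does not
  affect the limit of the roots.
\<close>

lemma (in fin_digraph) upstream_scc_branching_le:
  assumes H: "H \<in> upstream_sccs G i" and lim: "branching_seq G i \<longlonglongrightarrow> d"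
  shows "network_branching_ratio H \<le> d"
proof -
  have H: "induced_subgraph H G" "strongly_connected H" and "verts H \<inter> upstream G i \<noteq> {}"
    using H by (simp_all add: upstream_sccs_def sccs_def)
  then obtain j q where j: "j \<in> verts H" and q: "awalk j q i"
    unfolding upstream_def by blast
  have sub: "subgraph H G" using H(1) by (rule induced_imp_subgraph)
  then have "fin_digraph H" by (rule fin_digraph_subgraph)
  then have limH: "branching_seq H j \<longlonglongrightarrow> network_branching_ratio H"
    using finite_distinct_list[OF fin_digraph.finite_verts] H(2) j
    by (blast intro: strongly_connected_branching(2))
  have d: "d \<ge> 0"
    using lim by (rule LIMSEQ_le_const) (auto intro!: exI[of _ 0] simp: branching_seq_def real_root_pos_pos_le)
  show ?thesis
  proof (rule dense_ge)
    fix s assume s: "d < s"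
    with d have s0: "s > 0" by simp
    have "\<forall>\<^sub>F l in sequentially. branching_seq G i (l + length q) < s"
      using order_tendstoD(2)[OF LIMSEQ_ignore_initial_segment[OF lim] s] .
    then have "\<forall>\<^sub>F l in sequentially. branching_seq H j l \<le> root l (s ^ length q * s ^ l)"
      using eventually_gt_at_top[of 0]
    proof eventually_elim
      case (elim l)
      have "card (walks_to H j l) \<le> card (walks_to G i (l + length q))"
        using card_walks_to_subgraph[OF sub] card_walks_to_append[OF q] by (rule order_trans)
      also have "real \<dots> = branching_seq G i (l + length q) ^ (l + length q)"
        using elim by (simp add: branching_seq_def)
      also have "\<dots> \<le> s ^ (l + length q)"
        using elim by (intro power_mono) (auto simp: branching_seq_def real_root_pos_pos_le)
      finally show ?case
        using elim by (simp add: branching_seq_def power_add mult.commute)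
    qed
    then show "network_branching_ratio H \<le> s"
      using s0 by (intro tendsto_le[OF _ root_exponential_tendsto limH]) auto
  qed
qed

text \<open>
  In the block triangular form of the adjacency matrix given by the components, an eigenvalue of the
  whole matrix is an eigenvalue of a diagonal block.  The block is found directly: take the component
  of a node of the support of \<open>w\<close> that has the fewest nodes upstream from it.
\<close>

lemma (in fin_digraph) eigenfunction_restrict_scc:
  assumes w: "eigenfunction (upstream_subnetwork G i) w \<mu>"
  shows "\<exists>H \<in> upstream_sccs G i. eigenfunction H w \<mu>"
proof -
  let ?U = "upstream_subnetwork G i"
  have VU: "verts ?U = upstream G i" by (simp add: upstream_subnetwork_def)
  define P where "P = (\<lambda>k. k \<in> upstream G i \<and> w k \<noteq> 0)"
  from w obtain k0 where "P k0" by (auto simp: eigenfunction_def VU P_def)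
  from ex_has_least_nat[of P, OF this, of "\<lambda>k. card (upstream G k)"]
  obtain k where "P k" and least: "\<forall>j. P j \<longrightarrow> card (upstream G k) \<le> card (upstream G j)"
    by blast
  then have k: "k \<in> upstream G i" "w k \<noteq> 0" by (simp_all add: P_def)
  have kV: "k \<in> verts G" using k(1) upstream_subset by blast
  (* Minimality of k: a node of the support upstream from k has the same upstream set as k. *)
  have return: "k \<rightarrow>\<^sup>*\<^bsub>G\<^esub> j" if j: "j \<rightarrow>\<^sup>*\<^bsub>G\<^esub> k" "w j \<noteq> 0" for j
  proof -
    have sub: "upstream G j \<subseteq> upstream G k"
      using reachable_trans[OF _ j(1)] by (auto simp: upstream_iff)
    moreover have "finite (upstream G k)" using upstream_subset by (rule finite_subset) simp
    moreover have "card (upstream G k) \<le> card (upstream G j)"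
      using least j(2) reachable_trans[OF j(1)] k(1) by (simp add: P_def upstream_iff)
    ultimately have "upstream G j = upstream G k" by (intro card_seteq) auto
    moreover have "k \<in> upstream G k" using kV by (simp add: upstream_iff)
    ultimately show ?thesis by (simp add: upstream_iff[symmetric])
  qed
  define S where "S = scc_of k"
  let ?H = "G \<restriction> S"
  have kS: "k \<in> S" using kV by (simp add: S_def scc_of_def)
  have "\<forall>u \<in> S. \<forall>v \<in> S. u \<rightarrow>\<^sup>*\<^bsub>G\<^esub> v"
    unfolding S_def scc_of_def using reachable_trans by blast
  moreover have "v \<in> S" if "u \<in> S" "u \<rightarrow>\<^sup>*\<^bsub>G\<^esub> v" "v \<rightarrow>\<^sup>*\<^bsub>G\<^esub> u" for u v
    using that reachable_trans unfolding S_def scc_of_def by blast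
  ultimately have "S \<in> sccs_verts"
    using kS unfolding in_sccs_verts_conv_reachable by blast
  then have "?H \<in> sccs" by (rule in_verts_sccsD_sccs)
  then have "?H \<in> upstream_sccs G i" using kS k(1) by (auto simp: upstream_sccs_def)
  moreover have "eigenfunction ?H w \<mu>"
    unfolding eigenfunction_def
  proof (intro conjI ballI)
    show "\<exists>k \<in> verts ?H. w k \<noteq> 0" using kS k(2) by auto
    fix v assume "v \<in> verts ?H"
    then have vS: "v \<in> S" by simp
    then have vk: "v \<rightarrow>\<^sup>*\<^bsub>G\<^esub> k" by (simp add: S_def scc_of_def)
    then have vU: "v \<in> upstream G i" using reachable_trans[OF vk] k(1) by (simp add: upstream_iff)
    have "(\<Sum>e \<in> in_arcs ?H v. w (tail G e)) = (\<Sum>e \<in> in_arcs G v. w (tail G e))"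
    proof (rule sum.mono_neutral_left)
      show "in_arcs ?H v \<subseteq> in_arcs G v" by (auto simp: in_arcs_def)
      show "\<forall>e \<in> in_arcs G v - in_arcs ?H v. w (tail G e) = 0"
      proof (rule ballI, rule ccontr)
        fix e assume e: "e \<in> in_arcs G v - in_arcs ?H v" and "w (tail G e) \<noteq> 0"
        from e vk have "tail G e \<rightarrow>\<^sup>*\<^bsub>G\<^esub> k"
          using tail_in_upstream[of e v k] by (simp add: upstream_iff)
        with return \<open>w (tail G e) \<noteq> 0\<close> have "tail G e \<in> S" by (simp add: S_def scc_of_def)
        with e vS show False by (auto simp: in_arcs_def)
      qed
    qed auto
    also have "\<dots> = (\<Sum>e \<in> in_arcs ?U v. w (tail ?U e))"
      by (simp only: in_arcs_upstream_subnetwork[OF vU]) (simp add: upstream_subnetwork_def)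
    also have "\<dots> = \<mu> * w v"
      using w vU by (simp only: eigenfunction_def VU)
    finally show "(\<Sum>e \<in> in_arcs ?H v. w (tail ?H e)) = \<mu> * w v" by simp
  qed
  ultimately show ?thesis by blast
qed

theorem theorem7p2:
  fixes G :: "('a,'b) pre_digraph" and i :: 'a
  assumes "fin_digraph G" and "i \<in> verts G"
  shows "(branching_seq G i \<longlonglongrightarrow> branching_ratio G i \<and> branching_ratio G i \<ge> 0)
    \<and> (branching_ratio G i \<in> network_branching_ratio ` upstream_sccs G i
       \<and> (\<forall>H \<in> upstream_sccs G i. network_branching_ratio H \<le> branching_ratio G i))
    \<and> (\<forall>xs. distinct xs \<and> set xs = verts (upstream_subnetwork G i)
         \<longrightarrow> branching_ratio G i = perron_eigenvalue (adjacency_matrix (upstream_subnetwork G i) xs))"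
proof -
  interpret fin_digraph G by fact
  let ?U = "upstream_subnetwork G i"
  interpret U: fin_digraph ?U by (rule fin_digraph_upstream_subnetwork)
  have ratio: "branching_ratio G i = perron_eigenvalue (adjacency_matrix ?U xs)"
    and lim: "branching_seq G i \<longlonglongrightarrow> branching_ratio G i"
    if "distinct xs" "set xs = verts ?U" for xs
    using branching_seq_tendsto_perron[OF assms that] by (simp_all add: branching_ratio_def limI)
  obtain xs where xs: "distinct xs" "set xs = verts ?U"
    using finite_distinct_list[OF U.finite_verts] by blast
  have nonneg: "branching_ratio G i \<ge> 0"
    using lim[OF xs] by (rule LIMSEQ_le_const) (auto intro!: exI[of _ 0] simp: branching_seq_def real_root_pos_pos_le)
  have upper: "\<forall>H \<in> upstream_sccs G i. network_branching_ratio H \<le> branching_ratio G i"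
    using upstream_scc_branching_le[OF _ lim[OF xs]] by blast
  have "i \<in> verts ?U"
    using assms(2) by (simp add: upstream_subnetwork_def upstream_iff)
  then obtain \<mu> w where w: "eigenfunction ?U w \<mu>" and \<mu>: "cmod \<mu> = branching_ratio G i"
    using U.eigenfunction_perron_exists[OF xs] ratio[OF xs] by auto
  obtain H where H: "H \<in> upstream_sccs G i" and wH: "eigenfunction H w \<mu>"
    using eigenfunction_restrict_scc[OF w] by blast
  have sc: "strongly_connected H" and "subgraph H G"
    using H by (simp_all add: upstream_sccs_def sccs_def induced_imp_subgraph)
  then interpret H: fin_digraph H by (intro fin_digraph_subgraph)
  obtain ys where ys: "distinct ys" "set ys = verts H"
    using finite_distinct_list[OF H.finite_verts] by blast
  have "cmod \<mu> \<le> network_branching_ratio H"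
    using H.eigenfunction_le_perron[OF ys _ wH] sc
      strongly_connected_branching(1)[OF H.fin_digraph_axioms sc ys]
    by (auto simp: strongly_connected_def)
  with \<mu> upper H have "branching_ratio G i = network_branching_ratio H" by force
  with H have "branching_ratio G i \<in> network_branching_ratio ` upstream_sccs G i" by blast
  with lim[OF xs] nonneg upper ratio show ?thesis by blast
qed

end
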